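(* An almost paracontact metric 3-dimensional Walker manifold $(M,\varphi,\xi,\eta,g)$ is $\eta$-Einstein if and only if the following conditions hold: $$\xi_1=-\frac{f_{xy}}{f_{xx}},\ \xi_2=1,\ \xi_3=0\quad\text{or}\quad \xi_1=\frac{f_{xy}}{f_{xx}},\ \xi_2=-1,\ \xi_3=0;$$ $$f_{xy}^2-f_{xx}f_{yy}=0\neq f_{xx},$$ or equivalently the Ricci operator $Q$ of $M$ is of Segre type $\{11,1\}$ degenerate case and $\xi=\pm N$, where $N=-\frac{f_{xy}}{f_{xx}}\partial_x+\partial_y$ is the eigenvector of $Q$ for the eigenvalue $\lambda_1=0$.
   Context: A 3-dimensional Walker manifold is a 3-dimensional Lorentzian manifold $(M,g)$ admitting a parallel lightlike distribution of rank 1. An almost paracontact metric 3-dimensional Walker manifold $(M,\varphi,\xi,\eta,g)$ is such a manifold with the structure given, in local coordinates $(x,y,z)$ and with respect to $\{\partial_x,\partial_y,\partial_z\}$, by $$g=\begin{pmatrix}0&0&1\\0&1&0\\1&0&f\end{pmatrix},\quad \varphi=\begin{pmatrix}-\xi_2&\xi_1+f\xi_3&-f\xi_2\\ \xi_3&0&-\xi_1\\0&-\xi_3&\xi_2\end{pmatrix},$$ $\xi=\xi_1\partial_x+\xi_2\partial_y+\xi_3\partial_z$, $\eta=\xi_3dx+\xi_2dy+(\xi_1+f\xi_3)dz$, where $f=f(x,y,z)\in C^\infty(M)$ and $\xi_1,\xi_2,\xi_3\in C^\infty(M)$ satisfy $\xi_2^2+f\xi_3^2+2\xi_1\xi_3=1$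 (columns of $\varphi$ are the images of the basis vectors). Subscripts $x,y,z$ on functions denote partial derivatives. The Ricci tensor $\rho$ and Ricci operator $Q$ ($g(QX,Y)=\rho(X,Y)$) are, with respect to $\{\partial_x,\partial_y,\partial_z\}$, $$\rho=\tfrac12\begin{pmatrix}0&0&f_{xx}\\ 0&0&f_{xy}\\ f_{xx}&f_{xy}&ff_{xx}-f_{yy}\end{pmatrix},\qquad Q=\tfrac12\begin{pmatrix}f_{xx}&f_{xy}&-f_{yy}\\0&0&f_{xy}\\0&0&f_{xx}\end{pmatrix},$$ so $Q$ has eigenvalues $\lambda_1=0$, $\lambda_2=\lambda_3=\frac12f_{xx}$. $Q$ is of Segre type $\{11,1\}$ if it is diagonalizable; for a 3-dimensional Walker manifold, "Segre type $\{11,1\}$ degenerate case" refers to the case in which $f_{xy}^2-f_{xx}f_{yy}=0\neq f_{xx}$ at any point of $M$ (as distinguished from the "degenerate and flat case"). $M$ is $\eta$-Einstein if there exist two smooth functions $a,b$ on $M$ such that $\rho=ag+b\,\eta\otimes\eta$.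
   Formalization: "η-Einstein" is replaced in both equivalences by "η-Einstein and not flat at any point": literally the claim fails, e.g. f=0, ξ=∂_y gives ρ=0, so M is η-Einstein with a=b=0 although f_xx=0. The converse stays unconditional. *)

theory Defs
  imports "HOL-Analysis.Analysis"
begin

text \<open>
  Everything lives on an open set M of coordinates (x, y, z), a subset of real^3, with coordinate
  indices 1, 2, 3 for x, y, z. Tensor fields are given by their components with respect to the
  coordinate frame; values outside M are irrelevant, since M is open and all conditions are
  imposed at points of M only.
\<close>

section \<open>Smooth functions, Levi-Civita connection and curvature in coordinates\<close>

definition pd :: "'n::finite \<Rightarrow> (real^'n \<Rightarrow> real) \<Rightarrow> real^'n \<Rightarrow> real" where
  "pd i h p = frechet_derivative h (at p) (axis i 1)"

text \<open>
  C-infinity on an open set: every iterated partial derivative is differentiable, hence also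
  continuous, at every point. The differentiability also makes each \<^const>\<open>pd\<close> involved the
  genuine partial derivative.
\<close>

definition smooth_fun_on :: "(real^'n::finite) set \<Rightarrow> (real^'n \<Rightarrow> real) \<Rightarrow> bool" where
  "smooth_fun_on M h \<longleftrightarrow> (\<forall>is. \<forall>p\<in>M. (foldr pd is h) differentiable (at p))"

type_synonym 'n vector_field = "real^'n \<Rightarrow> real^'n"
type_synonym 'n matrix_field = "real^'n \<Rightarrow> real^'n^'n"

text \<open>\<open>christoffel g k i j\<close> is the Christoffel symbol with upper index k and lower indices i, j.\<close>

definition christoffel ::
    "'n::finite matrix_field \<Rightarrow> 'n \<Rightarrow> 'n \<Rightarrow> 'n \<Rightarrow> real^'n \<Rightarrow> real" where
  "christoffel g k i j p = 1/2 * (\<Sum>l\<in>UNIV. matrix_inv (g p) $ k $ l *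
     (pd i (\<lambda>q. g q $ j $ l) p + pd j (\<lambda>q. g q $ i $ l) p - pd l (\<lambda>q. g q $ i $ j) p))"

text \<open>
  \<open>riemann g l i j k\<close> is the component along the l-th coordinate vector of
  \<open>R(\<partial>\<^sub>i, \<partial>\<^sub>j) \<partial>\<^sub>k = \<nabla>\<^sub>i \<nabla>\<^sub>j \<partial>\<^sub>k - \<nabla>\<^sub>j \<nabla>\<^sub>i \<partial>\<^sub>k\<close>, and the Ricci tensor is \<open>\<rho>(Y,Z) = tr (X \<mapsto> R(X,Y)Z)\<close>.
\<close>

definition riemann ::
    "'n::finite matrix_field \<Rightarrow> 'n \<Rightarrow> 'n \<Rightarrow> 'n \<Rightarrow> 'n \<Rightarrow> real^'n \<Rightarrow> real" where
  "riemann g l i j k p =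
     pd i (christoffel g l j k) p - pd j (christoffel g l i k) p
     + (\<Sum>m\<in>UNIV. christoffel g l i m p * christoffel g m j k p
                  - christoffel g l j m p * christoffel g m i k p)"

definition flat_at :: "'n::finite matrix_field \<Rightarrow> real^'n \<Rightarrow> bool" where
  "flat_at g p \<longleftrightarrow> (\<forall>l i j k. riemann g l i j k p = 0)"

definition ricci :: "'n::finite matrix_field \<Rightarrow> 'n matrix_field" where
  "ricci g p = (\<chi> j k. \<Sum>i\<in>UNIV. riemann g i i j k p)"

definition ricci_operator :: "'n::finite matrix_field \<Rightarrow> 'n matrix_field" where
  "ricci_operator g p =
     (THE Q. \<forall>X Y. (Q *v X) \<bullet> (g p *v Y) = X \<bullet> (ricci g p *v Y))"

definition diagonalizable :: "real^'n^'n::finite \<Rightarrow> bool" where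
  "diagonalizable A \<longleftrightarrow> (\<exists>(P::real^'n^'n) D. invertible P \<and> (\<forall>i j. i \<noteq> j \<longrightarrow> D $ i $ j = 0) \<and>
     A = P ** D ** matrix_inv P)"

definition eta_einstein ::
    "(real^'n::finite) set \<Rightarrow> 'n matrix_field \<Rightarrow> 'n vector_field \<Rightarrow> bool" where
  "eta_einstein M g \<eta> \<longleftrightarrow> (\<exists>a b. smooth_fun_on M a \<and> smooth_fun_on M b \<and>
     (\<forall>p\<in>M. ricci g p = a p *\<^sub>R g p + b p *\<^sub>R (\<chi> i j. \<eta> p $ i * \<eta> p $ j)))"

section \<open>Almost paracontact metric 3-dimensional Walker manifolds\<close>

definition walker_metric :: "(real^3 \<Rightarrow> real) \<Rightarrow> 3 matrix_field" where
  "walker_metric f p = vector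
     [vector [0, 0, 1],
      vector [0, 1, 0],
      vector [1, 0, f p]]"

definition walker_phi :: "(real^3 \<Rightarrow> real) \<Rightarrow> (real^3 \<Rightarrow> real) \<Rightarrow> (real^3 \<Rightarrow> real) \<Rightarrow>
    (real^3 \<Rightarrow> real) \<Rightarrow> 3 matrix_field" where
  "walker_phi f \<xi>1 \<xi>2 \<xi>3 p = vector
     [vector [- \<xi>2 p, \<xi>1 p + f p * \<xi>3 p, - (f p * \<xi>2 p)],
      vector [\<xi>3 p, 0, - \<xi>1 p],
      vector [0, - \<xi>3 p, \<xi>2 p]]"

definition walker_xi :: "(real^3 \<Rightarrow> real) \<Rightarrow> (real^3 \<Rightarrow> real) \<Rightarrow> (real^3 \<Rightarrow> real) \<Rightarrow>
    3 vector_field" where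
  "walker_xi \<xi>1 \<xi>2 \<xi>3 p = vector [\<xi>1 p, \<xi>2 p, \<xi>3 p]"

definition walker_eta :: "(real^3 \<Rightarrow> real) \<Rightarrow> (real^3 \<Rightarrow> real) \<Rightarrow> (real^3 \<Rightarrow> real) \<Rightarrow>
    (real^3 \<Rightarrow> real) \<Rightarrow> 3 vector_field" where
  "walker_eta f \<xi>1 \<xi>2 \<xi>3 p = vector [\<xi>3 p, \<xi>2 p, \<xi>1 p + f p * \<xi>3 p]"

text \<open>
  Manifolds are connected by convention; this is what makes the sign of \<open>\<xi>2\<close> (equal to 1 or to -1)
  uniform on M. The Levi-Civita connection of this g makes the lightlike line field spanned by the
  first coordinate vector parallel.
\<close>

definition almost_paracontact_metric_walker ::
    "(real^3) set \<Rightarrow> (real^3 \<Rightarrow> real) \<Rightarrow>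
     (real^3 \<Rightarrow> real) \<Rightarrow> (real^3 \<Rightarrow> real) \<Rightarrow> (real^3 \<Rightarrow> real) \<Rightarrow>
     3 matrix_field \<Rightarrow> 3 vector_field \<Rightarrow> 3 vector_field \<Rightarrow> 3 matrix_field \<Rightarrow> bool" where
  "almost_paracontact_metric_walker M f \<xi>1 \<xi>2 \<xi>3 \<phi> \<xi> \<eta> g \<longleftrightarrow>
     open M \<and> connected M \<and>
     smooth_fun_on M f \<and> smooth_fun_on M \<xi>1 \<and> smooth_fun_on M \<xi>2 \<and> smooth_fun_on M \<xi>3 \<and>
     (\<forall>p\<in>M. (\<xi>2 p)\<^sup>2 + f p * (\<xi>3 p)\<^sup>2 + 2 * \<xi>1 p * \<xi>3 p = 1) \<and>
     g = walker_metric f \<and> \<phi> = walker_phi f \<xi>1 \<xi>2 \<xi>3 \<and>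
     \<xi> = walker_xi \<xi>1 \<xi>2 \<xi>3 \<and> \<eta> = walker_eta f \<xi>1 \<xi>2 \<xi>3"

text \<open>\<open>f_xy\<close> is differentiated in x first, then in y.\<close>

abbreviation f_xx :: "(real^3 \<Rightarrow> real) \<Rightarrow> real^3 \<Rightarrow> real" where
  "f_xx f \<equiv> pd 1 (pd 1 f)"

abbreviation f_xy :: "(real^3 \<Rightarrow> real) \<Rightarrow> real^3 \<Rightarrow> real" where
  "f_xy f \<equiv> pd 2 (pd 1 f)"

abbreviation f_yy :: "(real^3 \<Rightarrow> real) \<Rightarrow> real^3 \<Rightarrow> real" where
  "f_yy f \<equiv> pd 2 (pd 2 f)"

definition walker_N :: "(real^3 \<Rightarrow> real) \<Rightarrow> 3 vector_field" where
  "walker_N f p = vector [- (f_xy f p / f_xx f p), 1, 0]"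

text \<open>
  Segre type {11,1}, degenerate case: the Ricci operator is diagonalizable at every point, and the
  second clause separates this case from the degenerate and flat one, in which \<open>Q = 0\<close>.
\<close>

definition segre_11_1_degenerate :: "(real^3) set \<Rightarrow> (real^3 \<Rightarrow> real) \<Rightarrow> bool" where
  "segre_11_1_degenerate M f \<longleftrightarrow>
     (\<forall>p\<in>M. diagonalizable (ricci_operator (walker_metric f) p)) \<and>
     (\<forall>p\<in>M. (f_xy f p)\<^sup>2 - f_xx f p * f_yy f p = 0 \<and> f_xx f p \<noteq> 0)"

end

theory Submission
  imports Defs
begin

text \<open>
  If \<open>b\<close> vanishes at a point, the equation \<open>\<rho> = a g + b \<eta> \<otimes> \<eta>\<close> gives \<open>a = 0\<close> there by its \<open>yy\<close>
  component, hence \<open>f\<^sub>x\<^sub>x = f\<^sub>x\<^sub>y = f\<^sub>y\<^sub>y = 0\<close>, and then the whole curvature tensor vanishes at that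
  point. So non-flatness forces \<open>b \<noteq> 0\<close>. The \<open>xx\<close> component \<open>b \<xi>\<^sub>3\<^sup>2 = 0\<close> yields \<open>\<xi>\<^sub>3 = 0\<close>, so
  \<open>\<xi>\<^sub>2\<^sup>2 = 1\<close> by the normalisation of \<open>\<xi>\<close>, and the remaining components give \<open>a = -b = f\<^sub>x\<^sub>x / 2\<close>
  together with \<open>\<xi>\<^sub>1\<close> and \<open>f\<^sub>y\<^sub>y\<close>. Connectedness makes the sign of \<open>\<xi>\<^sub>2\<close> constant.
\<close>

section \<open>Calculus of \<open>pd\<close> and of smooth functions\<close>

lemma smooth_fun_on_pd:
  assumes "smooth_fun_on M h"
  shows "smooth_fun_on M (pd i h)"
  unfolding smooth_fun_on_def
proof (intro allI ballI)
  fix "is" p assume "p \<in> M"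
  then show "foldr pd is (pd i h) differentiable (at p)"
    \<comment> \<open>\<open>foldr\<close> applies the last list entry first, so the extra
      derivative \<open>pd i\<close> goes to the end of the list.\<close>
    using assms[unfolded smooth_fun_on_def, rule_format, of p "is @ [i]"] by simp
qed

lemma smooth_fun_on_imp_differentiable:
  "smooth_fun_on M h \<Longrightarrow> p \<in> M \<Longrightarrow> h differentiable (at p)"
  unfolding smooth_fun_on_def by (metis foldr.simps(1) id_apply)

lemma pd_eqI:
  "(h has_derivative h') (at p) \<Longrightarrow> pd i h p = h' (axis i 1)"
  unfolding pd_def by (metis frechet_derivative_at)

lemma pd_const: "pd i (\<lambda>q. c) = (\<lambda>p. 0)"
  by (rule ext, rule pd_eqI) (rule has_derivative_const)

lemma pd_add:
  assumes "u differentiable (at p)" "v differentiable (at p)"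
  shows "pd i (\<lambda>q. u q + v q) p = pd i u p + pd i v p"
  using pd_eqI[OF has_derivative_add[OF assms[unfolded frechet_derivative_works]]]
  by (simp add: pd_def)

lemma pd_mult:
  assumes "u differentiable (at p)" "v differentiable (at p)"
  shows "pd i (\<lambda>q. u q * v q) p = u p * pd i v p + pd i u p * v p"
  using pd_eqI[OF has_derivative_mult[OF assms[unfolded frechet_derivative_works]]]
  by (simp add: pd_def)

lemma pd_cmult:
  assumes "u differentiable (at p)"
  shows "pd i (\<lambda>q. c * u q) p = c * pd i u p"
  using pd_mult[OF differentiable_const assms] by (simp add: pd_const)

lemma pd_cong_open:
  assumes "open M" "p \<in> M" "\<And>q. q \<in> M \<Longrightarrow> u q = v q" "u differentiable (at p)"
  shows "pd i u p = pd i v p"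
  unfolding pd_def
  using frechet_derivative_transform_within_open[OF assms(4,1,2,3)] by simp

text \<open>Off \<open>M\<close> nothing is known about differentiability, so iterated derivatives
  of \<open>c * h\<close> and of \<open>h\<close> can be compared at points of \<open>M\<close>
  only. The induction uses that \<open>M\<close> is open to differentiate this equality, and
  openness also transfers differentiability at the end.\<close>

lemma smooth_fun_on_cmult:
  assumes "open M" and h: "smooth_fun_on M h"
  shows "smooth_fun_on M (\<lambda>p. c * h p)"
proof -
  have dh: "foldr pd is h differentiable (at p)" if "p \<in> M" for "is" p
    using h that by (auto simp: smooth_fun_on_def)
  have eq: "\<forall>p\<in>M. foldr pd is (\<lambda>p. c * h p) p = c * foldr pd is h p" for "is"
  proof (induction "is")
    case (Cons i "is")
    show ?case
    proof
      fix p assume p: "p \<in> M"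
      have "pd i (\<lambda>p. c * foldr pd is h p) p = pd i (foldr pd is (\<lambda>p. c * h p)) p"
        using Cons by (intro pd_cong_open[OF assms(1) p] differentiable_mult dh[OF p] differentiable_const) auto
      then show "foldr pd (i # is) (\<lambda>p. c * h p) p = c * foldr pd (i # is) h p"
        by (simp add: pd_cmult[OF dh[OF p]])
    qed
  qed simp
  show ?thesis
    unfolding smooth_fun_on_def
  proof (intro allI ballI)
    fix "is" p assume p: "p \<in> M"
    have "(\<lambda>p. c * foldr pd is h p) differentiable (at p)"
      by (intro differentiable_mult dh[OF p] differentiable_const)
    then obtain D where "((\<lambda>p. c * foldr pd is h p) has_derivative D) (at p)"
      by (auto simp: differentiable_def)
    then have "(foldr pd is (\<lambda>p. c * h p) has_derivative D) (at p)"
      by (rule has_derivative_transform_within_open[OF _ assms(1) p]) (use eq in auto)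
    then show "foldr pd is (\<lambda>p. c * h p) differentiable (at p)"
      by (auto simp: differentiable_def)
  qed
qed

section \<open>Symmetry of second partial derivatives\<close>

lemma has_real_derivative_along_axis:
  assumes "h differentiable (at (q + t *\<^sub>R axis i 1))"
  shows "((\<lambda>t. h (q + t *\<^sub>R axis i 1)) has_real_derivative pd i h (q + t *\<^sub>R axis i 1)) (at t)"
proof -
  let ?D = "frechet_derivative h (at (q + t *\<^sub>R axis i 1))"
  have lin: "linear ?D"
    using assms by (rule linear_frechet_derivative)
  have "((\<lambda>t. q + t *\<^sub>R axis i 1) has_derivative (\<lambda>s. s *\<^sub>R axis i 1)) (at t)"
    by (auto intro!: derivative_eq_intros)
  from diff_chain_at[OF this assms[unfolded frechet_derivative_works]]
  have "((\<lambda>t. h (q + t *\<^sub>R axis i 1)) has_derivative (\<lambda>s. ?D (s *\<^sub>R axis i 1))) (at t)"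
    by (simp add: o_def)
  moreover have "(\<lambda>s. ?D (s *\<^sub>R axis i 1)) = (*) (pd i h (q + t *\<^sub>R axis i 1))"
    by (auto simp: pd_def linear_cmul[OF lin])
  ultimately show ?thesis
    by (simp add: has_field_derivative_def)
qed

text \<open>Two applications of the one-variable mean value theorem along coordinate lines, first in
  direction \<open>i\<close>, then in direction \<open>j\<close>. The left-hand side is symmetric in
  \<open>i\<close> and \<open>j\<close>, which is what makes it useful for
  \<open>pd_commute\<close>.\<close>

lemma second_difference_mvt:
  fixes h :: "real^'n::finite \<Rightarrow> real"
  assumes s: "0 < s"
    and h: "\<And>q. q \<in> cball p (2 * s) \<Longrightarrow> h differentiable (at q)"
      "\<And>q. q \<in> cball p (2 * s) \<Longrightarrow> pd i h differentiable (at q)"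
  obtains t u where "0 < t" "t < s" "0 < u" "u < s"
    "h (p + s *\<^sub>R axis i 1 + s *\<^sub>R axis j 1) - h (p + s *\<^sub>R axis i 1) - h (p + s *\<^sub>R axis j 1) + h p
      = s\<^sup>2 * pd j (pd i h) (p + t *\<^sub>R axis i 1 + u *\<^sub>R axis j 1)"
proof -
  \<comment> \<open>Each of the two displacements has length at most \<open>s\<close>, whence the
    radius \<open>2 * s\<close>.\<close>
  have mem: "p + t *\<^sub>R axis i 1 + u *\<^sub>R axis j 1 \<in> cball p (2 * s)"
    if "0 \<le> t" "t \<le> s" "0 \<le> u" "u \<le> s" for t u
    using norm_triangle_ineq[of "t *\<^sub>R axis i (1::real)" "u *\<^sub>R axis j 1"] that
    by (subst mem_cball, subst dist_commute) (simp add: dist_norm add.assoc)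
  have mem0: "p + t *\<^sub>R axis i 1 \<in> cball p (2 * s)" if "0 \<le> t" "t \<le> s" for t
    using mem[OF that, of 0] s by simp
  \<comment> \<open>The increment of \<open>h\<close> in direction \<open>j\<close>, followed along
    direction \<open>i\<close>: the second difference is
    \<open>?\<phi> s - ?\<phi> 0\<close>.\<close>
  let ?\<phi> = "\<lambda>t. h (p + s *\<^sub>R axis j 1 + t *\<^sub>R axis i 1) - h (p + t *\<^sub>R axis i 1)"
  have "\<exists>t. 0 < t \<and> t < s \<and> ?\<phi> s - ?\<phi> 0 =
      (s - 0) * (pd i h (p + s *\<^sub>R axis j 1 + t *\<^sub>R axis i 1) - pd i h (p + t *\<^sub>R axis i 1))"
    using s mem[of _ s] mem0
    by (intro MVT2 derivative_intros has_real_derivative_along_axis h)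
       (auto simp: algebra_simps)
  then obtain t where t: "0 < t" "t < s" and 1: "?\<phi> s - ?\<phi> 0 =
      s * (pd i h (p + s *\<^sub>R axis j 1 + t *\<^sub>R axis i 1) - pd i h (p + t *\<^sub>R axis i 1))"
    by auto
  let ?\<psi> = "\<lambda>u. pd i h (p + t *\<^sub>R axis i 1 + u *\<^sub>R axis j 1)"
  have "\<exists>u. 0 < u \<and> u < s \<and> ?\<psi> s - ?\<psi> 0 =
      (s - 0) * pd j (pd i h) (p + t *\<^sub>R axis i 1 + u *\<^sub>R axis j 1)"
    using s mem t
    by (intro MVT2 has_real_derivative_along_axis h) auto
  then obtain u where u: "0 < u" "u < s" and 2: "?\<psi> s - ?\<psi> 0 =
      s * pd j (pd i h) (p + t *\<^sub>R axis i 1 + u *\<^sub>R axis j 1)"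
    by auto
  show thesis
    using 1 2 by (intro that[OF t u]) (simp add: algebra_simps power2_eq_square)
qed

text \<open>The symmetric second difference over a small square equals \<open>s\<^sup>2\<close>
  times either mixed derivative, each at some point near \<open>p\<close>. So the two mixed
  derivatives agree at nearby points, and their continuity rules out different values at
  \<open>p\<close>.\<close>

lemma pd_commute:
  fixes h :: "real^'n::finite \<Rightarrow> real"
  assumes "open M" "p \<in> M" and h: "smooth_fun_on M h"
  shows "pd i (pd j h) p = pd j (pd i h) p"
proof (rule ccontr)
  let ?A = "pd i (pd j h)" and ?B = "pd j (pd i h)"
  assume neq: "?A p \<noteq> ?B p"
  \<comment> \<open>With half the gap as radius, the open intervals around \<open>?A p\<close> and
    \<open>?B p\<close> are disjoint.\<close>
  define e where "e = \<bar>?A p - ?B p\<bar> / 2"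
  have e: "0 < e" using neq by (simp add: e_def)
  have cont: "\<exists>d>0. \<forall>q. dist q p < d \<longrightarrow> dist (pd k (pd l h) q) (pd k (pd l h) p) < e" for k l
    using smooth_fun_on_imp_differentiable[OF smooth_fun_on_pd[OF smooth_fun_on_pd[OF h]] assms(2)]
      e differentiable_imp_continuous_within continuous_at_eps_delta
    by (metis (no_types, lifting))
  obtain d1 where d1: "0 < d1" "\<And>q. dist q p < d1 \<Longrightarrow> dist (?A q) (?A p) < e"
    using cont by blast
  obtain d2 where d2: "0 < d2" "\<And>q. dist q p < d2 \<Longrightarrow> dist (?B q) (?B p) < e"
    using cont by blast
  obtain r where r: "0 < r" "cball p r \<subseteq> M"
    using assms(1,2) open_contains_cball by blast
  define s where "s = min r (min d1 d2) / 2"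
  have s: "0 < s" "2 * s \<le> r" "2 * s \<le> d1" "2 * s \<le> d2"
    using r d1 d2 by (auto simp: s_def)
  have near: "dist (p + t *\<^sub>R axis k 1 + u *\<^sub>R axis l 1) p < 2 * s"
    if "0 < t" "t < s" "0 < u" "u < s" for t u and k l :: 'n
    using norm_triangle_ineq[of "t *\<^sub>R axis k (1::real)" "u *\<^sub>R axis l 1"] that
    by (simp add: dist_norm add.assoc)
  have sub: "q \<in> M" if "q \<in> cball p (2 * s)" for q
    using that r(2) s(2) by (auto simp: subset_iff)
  have diffs: "h differentiable (at q)" "pd k h differentiable (at q)"
    if "q \<in> cball p (2 * s)" for q k
    using sub[OF that] h smooth_fun_on_pd smooth_fun_on_imp_differentiable by blast+
  obtain t u where tu: "0 < t" "t < s" "0 < u" "u < s" and 1: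
    "h (p + s *\<^sub>R axis i 1 + s *\<^sub>R axis j 1) - h (p + s *\<^sub>R axis i 1) - h (p + s *\<^sub>R axis j 1) + h p
      = s\<^sup>2 * ?B (p + t *\<^sub>R axis i 1 + u *\<^sub>R axis j 1)"
    using second_difference_mvt[OF s(1) diffs] by blast
  \<comment> \<open>The same square with the roles of \<open>i\<close> and \<open>j\<close>
    exchanged.\<close>
  obtain t' u' where tu': "0 < t'" "t' < s" "0 < u'" "u' < s" and 2:
    "h (p + s *\<^sub>R axis j 1 + s *\<^sub>R axis i 1) - h (p + s *\<^sub>R axis j 1) - h (p + s *\<^sub>R axis i 1) + h p
      = s\<^sup>2 * ?A (p + t' *\<^sub>R axis j 1 + u' *\<^sub>R axis i 1)"
    using second_difference_mvt[OF s(1) diffs] by blast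
  have "s\<^sup>2 * ?B (p + t *\<^sub>R axis i 1 + u *\<^sub>R axis j 1)
      = s\<^sup>2 * ?A (p + t' *\<^sub>R axis j 1 + u' *\<^sub>R axis i 1)"
    using 1 2 by (simp add: algebra_simps)
  then have "?B (p + t *\<^sub>R axis i 1 + u *\<^sub>R axis j 1) = ?A (p + t' *\<^sub>R axis j 1 + u' *\<^sub>R axis i 1)"
    using s(1) by simp
  moreover have "dist (?B (p + t *\<^sub>R axis i 1 + u *\<^sub>R axis j 1)) (?B p) < e"
    using near[OF tu] s(4) by (intro d2) (rule less_le_trans)
  moreover have "dist (?A (p + t' *\<^sub>R axis j 1 + u' *\<^sub>R axis i 1)) (?A p) < e"
    using near[OF tu'] s(3) by (intro d1) (rule less_le_trans)
  ultimately show False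
    unfolding e_def dist_real_def by (simp add: field_simps abs_if split: if_splits)
qed

section \<open>Inverse metric, Christoffel symbols and a criterion for diagonalizability\<close>

lemma matrix_inv_eqI:
  fixes A B :: "real^'n^'n"
  assumes "A ** B = mat 1"
  shows "matrix_inv A = B"
proof -
  have BA: "B ** A = mat 1"
    using assms by (simp add: matrix_left_right_inverse)
  then have "A ** matrix_inv A = mat 1"
    unfolding matrix_inv_def using assms by (metis (mono_tags, lifting) someI_ex)
  then show ?thesis
    by (metis BA matrix_mul_assoc matrix_mul_lid matrix_mul_rid)
qed

lemma matrix_inv_walker_metric:
  "matrix_inv (walker_metric f p) = vector [vector [- f p, 0, 1], vector [0, 1, 0], vector [1, 0, 0]]"
  by (rule matrix_inv_eqI)
     (simp add: walker_metric_def vec_eq_iff forall_3 matrix_matrix_mult_def sum_3 mat_def)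

text \<open>The only nonconstant metric entry is \<open>f\<close> in position (3,3). The symbols are
  given as equations between functions because \<open>riemann\<close> differentiates them.\<close>

lemma christoffel_walker:
  "christoffel (walker_metric f) 1 1 3 = (\<lambda>p. 1/2 * pd 1 f p)"
  "christoffel (walker_metric f) 1 2 3 = (\<lambda>p. 1/2 * pd 2 f p)"
  "christoffel (walker_metric f) 1 3 1 = (\<lambda>p. 1/2 * pd 1 f p)"
  "christoffel (walker_metric f) 1 3 2 = (\<lambda>p. 1/2 * pd 2 f p)"
  "christoffel (walker_metric f) 1 3 3 = (\<lambda>p. 1/2 * (f p * pd 1 f p + pd 3 f p))"
  "christoffel (walker_metric f) 2 3 3 = (\<lambda>p. - (1/2) * pd 2 f p)"
  "christoffel (walker_metric f) 3 3 3 = (\<lambda>p. - (1/2) * pd 1 f p)"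
  "christoffel (walker_metric f) 1 1 1 = (\<lambda>p. 0)"
  "christoffel (walker_metric f) 1 1 2 = (\<lambda>p. 0)"
  "christoffel (walker_metric f) 1 2 1 = (\<lambda>p. 0)"
  "christoffel (walker_metric f) 1 2 2 = (\<lambda>p. 0)"
  "christoffel (walker_metric f) 2 1 1 = (\<lambda>p. 0)"
  "christoffel (walker_metric f) 2 1 2 = (\<lambda>p. 0)"
  "christoffel (walker_metric f) 2 1 3 = (\<lambda>p. 0)"
  "christoffel (walker_metric f) 2 2 1 = (\<lambda>p. 0)"
  "christoffel (walker_metric f) 2 2 2 = (\<lambda>p. 0)"
  "christoffel (walker_metric f) 2 2 3 = (\<lambda>p. 0)"
  "christoffel (walker_metric f) 2 3 1 = (\<lambda>p. 0)"
  "christoffel (walker_metric f) 2 3 2 = (\<lambda>p. 0)"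
  "christoffel (walker_metric f) 3 1 1 = (\<lambda>p. 0)"
  "christoffel (walker_metric f) 3 1 2 = (\<lambda>p. 0)"
  "christoffel (walker_metric f) 3 1 3 = (\<lambda>p. 0)"
  "christoffel (walker_metric f) 3 2 1 = (\<lambda>p. 0)"
  "christoffel (walker_metric f) 3 2 2 = (\<lambda>p. 0)"
  "christoffel (walker_metric f) 3 2 3 = (\<lambda>p. 0)"
  "christoffel (walker_metric f) 3 3 1 = (\<lambda>p. 0)"
  "christoffel (walker_metric f) 3 3 2 = (\<lambda>p. 0)"
  unfolding christoffel_def[abs_def] sum_3 matrix_inv_walker_metric
  by (simp_all add: walker_metric_def pd_const fun_eq_iff field_simps)

text \<open>The form \<open>A ** P = P ** D\<close> lets eigenvectors be checked column by column,
  without computing the inverse of \<open>P\<close>.\<close>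

lemma diagonalizableI:
  fixes A P D :: "real^'n^'n"
  assumes "A ** P = P ** D" "invertible P" "\<forall>i j. i \<noteq> j \<longrightarrow> D $ i $ j = 0"
  shows "diagonalizable A"
proof -
  obtain P' where P': "P ** P' = mat 1"
    using assms(2) by (auto simp: invertible_def)
  then have "A = P ** D ** matrix_inv P"
    using assms(1) matrix_inv_eqI[OF P'] by (metis matrix_mul_assoc matrix_mul_rid)
  then show ?thesis
    using assms unfolding diagonalizable_def by blast
qed

section \<open>Curvature, Ricci operator and its kernel at a point of \<open>M\<close>\<close>

context
  fixes M :: "(real^3) set" and f :: "real^3 \<Rightarrow> real" and p :: "real^3"
  assumes M: "open M" and f: "smooth_fun_on M f" and p: "p \<in> M"
begin

text \<open>One rule for each shape of the nonzero Christoffel symbols.\<close>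

lemma pd_christoffel_walker:
  "pd l (\<lambda>p. 1/2 * pd i f p) p = 1/2 * pd l (pd i f) p"
  "pd l (\<lambda>p. - (1/2) * pd i f p) p = - (1/2) * pd l (pd i f) p"
  "pd l (\<lambda>p. 1/2 * (f p * pd i f p + pd j f p)) p =
    1/2 * (f p * pd l (pd i f) p + pd l f p * pd i f p + pd l (pd j f) p)"
proof -
  have "f differentiable (at p)" "pd i f differentiable (at p)" for i
    using f p smooth_fun_on_pd smooth_fun_on_imp_differentiable by blast+
  then show
    "pd l (\<lambda>p. 1/2 * pd i f p) p = 1/2 * pd l (pd i f) p"
    "pd l (\<lambda>p. - (1/2) * pd i f p) p = - (1/2) * pd l (pd i f) p"
    "pd l (\<lambda>p. 1/2 * (f p * pd i f p + pd j f p)) p =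
      1/2 * (f p * pd l (pd i f) p + pd l f p * pd i f p + pd l (pd j f) p)"
    by (simp_all only: pd_cmult pd_add pd_mult differentiable_add differentiable_mult)
qed

text \<open>Contraction produces mixed derivatives in both orders. Symmetry brings the x-y ones to
  the form \<open>f_xy\<close> and cancels the x-z ones in the (3,3) entry.\<close>

lemma ricci_walker:
  "ricci (walker_metric f) p = (1/2) *\<^sub>R vector
     [vector [0, 0, f_xx f p],
      vector [0, 0, f_xy f p],
      vector [f_xx f p, f_xy f p, f p * f_xx f p - f_yy f p]]"
  unfolding vec_eq_iff forall_3 ricci_def vec_lambda_beta sum_3 riemann_def
    christoffel_walker pd_christoffel_walker pd_const
  using pd_commute[OF M p f, of 1 2] pd_commute[OF M p f, of 1 3]
  by (simp add: field_simps)

text \<open>Products of first derivatives cancel, and second derivatives involving z cancel by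
  symmetry, so every curvature component is a combination of \<open>f_xx\<close>,
  \<open>f_xy\<close> and \<open>f_yy\<close>.\<close>

lemma flat_at_walker:
  assumes "f_xx f p = 0" "f_xy f p = 0" "f_yy f p = 0"
  shows "flat_at (walker_metric f) p"
  unfolding flat_at_def forall_3 riemann_def sum_3 christoffel_walker pd_christoffel_walker pd_const
  using assms pd_commute[OF M p f, of 1 2] pd_commute[OF M p f, of 1 3] pd_commute[OF M p f, of 2 3]
  by (simp add: field_simps)

text \<open>The definite description needs uniqueness as well, which comes from nondegeneracy: the
  vectors \<open>walker_metric f p *v Y\<close> exhaust the space, so \<open>Q *v X\<close> is
  determined by its inner products with them.\<close>

lemma ricci_operator_walker:
  "ricci_operator (walker_metric f) p = (1/2) *\<^sub>R vector
     [vector [f_xx f p, f_xy f p, - f_yy f p],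
      vector [0, 0, f_xy f p],
      vector [0, 0, f_xx f p]]" (is "_ = ?Q")
  unfolding ricci_operator_def ricci_walker
proof (rule the_equality, intro allI)
  let ?\<rho> = "(1/2) *\<^sub>R vector
     [vector [0, 0, f_xx f p],
      vector [0, 0, f_xy f p],
      vector [f_xx f p, f_xy f p, f p * f_xx f p - f_yy f p]] :: real^3^3"
  show Q: "(?Q *v X) \<bullet> (walker_metric f p *v Y) = X \<bullet> (?\<rho> *v Y)" for X Y
    by (simp add: walker_metric_def inner_vec_def matrix_vector_mult_def sum_3 field_simps)
  fix Q' assume Q': "\<forall>X Y. (Q' *v X) \<bullet> (walker_metric f p *v Y) = X \<bullet> (?\<rho> *v Y)"
  \<comment> \<open>The witness is the inverse metric applied to \<open>Z\<close>.\<close>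
  have surj: "\<exists>Y. walker_metric f p *v Y = Z" for Z
    by (rule exI[of _ "vector [Z $ 3 - f p * Z $ 1, Z $ 2, Z $ 1]"])
       (simp add: walker_metric_def vec_eq_iff forall_3 matrix_vector_mult_def sum_3)
  have "Q' *v X = ?Q *v X" for X
  proof (rule vector_eq_rdot[THEN iffD1], rule allI)
    fix Z
    obtain Y where "walker_metric f p *v Y = Z" using surj by blast
    then show "(Q' *v X) \<bullet> Z = (?Q *v X) \<bullet> Z"
      using Q Q' by metis
  qed
  then show "Q' = ?Q"
    by (simp add: matrix_eq)
qed

text \<open>The columns of \<open>?P\<close> are eigenvectors: the first coordinate vector for
  \<open>f_xx f p / 2\<close>, then \<open>walker_N f p\<close> for 0, then (0, \<open>f_xy\<close>,
  \<open>f_xx\<close>) for \<open>f_xx f p / 2\<close> again. The last is an eigenvector exactly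
  because \<open>(f_xy f p)\<^sup>2 - f_xx f p * f_yy f p\<close> vanishes.\<close>

lemma diagonalizable_ricci_operator_walker:
  assumes "(f_xy f p)\<^sup>2 - f_xx f p * f_yy f p = 0" "f_xx f p \<noteq> 0"
  shows "diagonalizable (ricci_operator (walker_metric f) p)"
proof -
  let ?P = "vector
     [vector [1, - (f_xy f p / f_xx f p), 0],
      vector [0, 1, f_xy f p],
      vector [0, 0, f_xx f p]] :: real^3^3"
  let ?D = "vector
     [vector [f_xx f p / 2, 0, 0],
      vector [0, 0, 0],
      vector [0, 0, f_xx f p / 2]] :: real^3^3"
  have "ricci_operator (walker_metric f) p ** ?P = ?P ** ?D"
    using assms
    by (simp add: ricci_operator_walker vec_eq_iff forall_3 matrix_matrix_mult_def sum_3
        field_simps power2_eq_square)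
  moreover have "invertible ?P"
    using assms by (simp add: invertible_det_nz det_3)
  moreover have "\<forall>i j. i \<noteq> j \<longrightarrow> ?D $ i $ j = 0"
    by (simp add: forall_3)
  ultimately show ?thesis
    by (intro diagonalizableI)
qed

text \<open>The third row forces \<open>v $ 3 = 0\<close>, and the first row then expresses
  \<open>v $ 1\<close> through \<open>v $ 2\<close>. As \<open>walker_N\<close> has second component
  1, the multiple is \<open>v $ 2\<close>.\<close>

lemma ricci_operator_kernel_walker:
  assumes nz: "f_xx f p \<noteq> 0"
  shows "{v. ricci_operator (walker_metric f) p *v v = 0} = span {walker_N f p}"
proof (intro equalityI subsetI)
  fix v assume "v \<in> {v. ricci_operator (walker_metric f) p *v v = 0}"
  then have "f_xx f p * v $ 1 + f_xy f p * v $ 2 - f_yy f p * v $ 3 = 0" "f_xx f p * v $ 3 = 0"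
    by (simp_all add: ricci_operator_walker vec_eq_iff forall_3 matrix_vector_mult_def sum_3 field_simps)
  then have "v = v $ 2 *\<^sub>R walker_N f p"
    using nz by (simp add: walker_N_def vec_eq_iff forall_3 field_simps)
  then show "v \<in> span {walker_N f p}"
    by (metis span_base span_scale singletonI)
next
  fix v assume "v \<in> span {walker_N f p}"
  then obtain c where "v = c *\<^sub>R walker_N f p"
    by (auto simp: span_singleton)
  then show "v \<in> {v. ricci_operator (walker_metric f) p *v v = 0}"
    using nz
    by (simp add: ricci_operator_walker walker_N_def vec_eq_iff forall_3 matrix_vector_mult_def sum_3)
qed

section \<open>The eta-Einstein equation and non-flatness at a point\<close>

text \<open>The equation involves only the values at \<open>p\<close> of the two coefficients and of
  the components of the vector field, so these are plain reals; derivatives are taken of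
  \<open>f\<close> alone.\<close>

lemma eta_einstein_walker_pointwise:
  fixes x1 x2 x3 a b :: real
  defines "\<eta> \<equiv> vector [x3, x2, x1 + f p * x3] :: real^3"
  assumes norm: "x2\<^sup>2 + f p * x3\<^sup>2 + 2 * x1 * x3 = 1"
    and eq: "ricci (walker_metric f) p = a *\<^sub>R walker_metric f p + b *\<^sub>R (\<chi> i j. \<eta> $ i * \<eta> $ j)"
    and "\<not> flat_at (walker_metric f) p"
  shows "f_xx f p \<noteq> 0" "x3 = 0" "x2\<^sup>2 = 1" "x1 = - (x2 * f_xy f p / f_xx f p)"
    "(f_xy f p)\<^sup>2 - f_xx f p * f_yy f p = 0"
proof -
  have e11: "b * x3\<^sup>2 = 0" and e22: "a + b * x2\<^sup>2 = 0"
    and e13: "f_xx f p = 2 * (a + b * (x3 * (x1 + f p * x3)))"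
    and e23: "f_xy f p = 2 * (b * (x2 * (x1 + f p * x3)))"
    and e33: "f p * f_xx f p - f_yy f p = 2 * (a * f p + b * (x1 + f p * x3)\<^sup>2)"
    using eq
    by (auto simp: \<eta>_def ricci_walker walker_metric_def vec_eq_iff forall_3 field_simps power2_eq_square)
  have b: "b \<noteq> 0"
  proof
    assume "b = 0"
    then show False
      using assms(4) e22 e13 e23 e33 flat_at_walker by simp
  qed
  show x3: "x3 = 0"
    using e11 b by simp
  show x2: "x2\<^sup>2 = 1"
    using norm x3 by simp
  have fxx: "f_xx f p = - 2 * b"
    using e13 e22 x2 x3 by simp
  then show nz: "f_xx f p \<noteq> 0"
    using b by simp
  have fxy: "f_xy f p = 2 * b * x1 * x2"
    using e23 x3 by simp
  \<comment> \<open>Since \<open>x2\<^sup>2 = 1\<close>, multiplying by \<open>x2\<close> amounts to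
    dividing by it; both signs are treated at once.\<close>
  have "x2 * f_xy f p = 2 * b * x1 * x2\<^sup>2"
    by (simp add: fxy power2_eq_square)
  then show "x1 = - (x2 * f_xy f p / f_xx f p)"
    using b by (simp add: fxx x2)
  have fyy: "f_yy f p = - 2 * b * x1\<^sup>2"
  proof -
    have "a = - b" using e22 x2 by simp
    then show ?thesis using e33 x3 by (simp add: fxx)
  qed
  have "(f_xy f p)\<^sup>2 = 4 * b\<^sup>2 * x1\<^sup>2 * x2\<^sup>2"
    by (simp add: fxy power_mult_distrib)
  also have "\<dots> = 4 * b\<^sup>2 * x1\<^sup>2"
    by (simp add: x2)
  finally show "(f_xy f p)\<^sup>2 - f_xx f p * f_yy f p = 0"
    by (simp add: fxx fyy power2_eq_square)
qed

text \<open>The coefficients are those forced in the other direction. The facts \<open>1\<close> and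
  \<open>2\<close> settle the entries (3,3) and (2,3); the (2,2) entry is
  \<open>x2\<^sup>2 = 1\<close>.\<close>

lemma eta_einstein_walker_pointwise_conv:
  fixes x1 x2 :: real
  defines "\<eta> \<equiv> vector [0, x2, x1] :: real^3"
  assumes nz: "f_xx f p \<noteq> 0" and x2: "x2\<^sup>2 = 1" and x1: "x1 = - (x2 * f_xy f p / f_xx f p)"
    and deg: "(f_xy f p)\<^sup>2 - f_xx f p * f_yy f p = 0"
  shows "ricci (walker_metric f) p =
    (1/2 * f_xx f p) *\<^sub>R walker_metric f p + (- (1/2) * f_xx f p) *\<^sub>R (\<chi> i j. \<eta> $ i * \<eta> $ j)"
proof -
  have 1: "f_xx f p * (x1 * x1) = f_yy f p"
    using nz deg x2 by (simp add: x1 field_simps power2_eq_square)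
  have 2: "f_xx f p * (x1 * x2) = - f_xy f p"
    using nz x2 by (simp add: x1 field_simps power2_eq_square)
  show ?thesis
    using x2 1 2
    by (simp add: \<eta>_def ricci_walker walker_metric_def vec_eq_iff forall_3 field_simps power2_eq_square)
qed

text \<open>Vanishing curvature contracts to a vanishing Ricci tensor, whose (1,3) entry is half of
  \<open>f_xx f p\<close>.\<close>

lemma not_flat_at_walker:
  assumes "f_xx f p \<noteq> 0"
  shows "\<not> flat_at (walker_metric f) p"
proof
  assume "flat_at (walker_metric f) p"
  then have "ricci (walker_metric f) p = 0"
    by (simp add: flat_at_def ricci_def vec_eq_iff)
  then have "ricci (walker_metric f) p $ 1 $ 3 = 0"
    by simp
  then show False
    using assms unfolding ricci_walker by simp
qed

end

section \<open>The equivalences and the kernel of the Ricci operator on all of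
  \<open>M\<close>\<close>

theorem theorem5p1:
  fixes M :: "(real^3) set" and f \<xi>1 \<xi>2 \<xi>3 :: "real^3 \<Rightarrow> real"
    and \<phi> g :: "real^3 \<Rightarrow> real^3^3" and \<xi> \<eta> :: "real^3 \<Rightarrow> real^3"
  assumes "almost_paracontact_metric_walker M f \<xi>1 \<xi>2 \<xi>3 \<phi> \<xi> \<eta> g"
  shows "(eta_einstein M g \<eta> \<and> (\<forall>p\<in>M. \<not> flat_at g p) \<longleftrightarrow>
           ((\<forall>p\<in>M. \<xi>1 p = - (f_xy f p / f_xx f p) \<and> \<xi>2 p = 1 \<and> \<xi>3 p = 0) \<or>
            (\<forall>p\<in>M. \<xi>1 p = f_xy f p / f_xx f p \<and> \<xi>2 p = - 1 \<and> \<xi>3 p = 0)) \<and>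
           (\<forall>p\<in>M. (f_xy f p)\<^sup>2 - f_xx f p * f_yy f p = 0 \<and> f_xx f p \<noteq> 0))
       \<and> (eta_einstein M g \<eta> \<and> (\<forall>p\<in>M. \<not> flat_at g p) \<longleftrightarrow>
           segre_11_1_degenerate M f \<and>
           ((\<forall>p\<in>M. \<xi> p = walker_N f p) \<or> (\<forall>p\<in>M. \<xi> p = - walker_N f p)))
       \<and> (segre_11_1_degenerate M f \<longrightarrow>
           (\<forall>p\<in>M. walker_N f p \<noteq> 0 \<and>
             {v. ricci_operator g p *v v = 0 *\<^sub>R v} = span {walker_N f p}))"
proof -
  have M: "open M" "connected M"
    and smooth: "smooth_fun_on M f" "smooth_fun_on M \<xi>2"
    and norm: "\<And>p. p \<in> M \<Longrightarrow> (\<xi>2 p)\<^sup>2 + f p * (\<xi>3 p)\<^sup>2 + 2 * \<xi>1 p * \<xi>3 p = 1"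
    and g: "g = walker_metric f" and \<xi>: "\<xi> = walker_xi \<xi>1 \<xi>2 \<xi>3"
    and \<eta>: "\<eta> = walker_eta f \<xi>1 \<xi>2 \<xi>3"
    using assms by (auto simp: almost_paracontact_metric_walker_def)
  let ?deg = "\<forall>p\<in>M. (f_xy f p)\<^sup>2 - f_xx f p * f_yy f p = 0 \<and> f_xx f p \<noteq> 0"
  let ?plus = "\<forall>p\<in>M. \<xi>1 p = - (f_xy f p / f_xx f p) \<and> \<xi>2 p = 1 \<and> \<xi>3 p = 0"
  let ?minus = "\<forall>p\<in>M. \<xi>1 p = f_xy f p / f_xx f p \<and> \<xi>2 p = - 1 \<and> \<xi>3 p = 0"
  have forward: "(?plus \<or> ?minus) \<and> ?deg"
    if ein: "eta_einstein M g \<eta>" and nonflat: "\<forall>p\<in>M. \<not> flat_at g p"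
  proof -
    have pointwise: "f_xx f p \<noteq> 0" "\<xi>3 p = 0" "(\<xi>2 p)\<^sup>2 = 1" "\<xi>1 p = - (\<xi>2 p * f_xy f p / f_xx f p)"
      "(f_xy f p)\<^sup>2 - f_xx f p * f_yy f p = 0" if p: "p \<in> M" for p
    proof -
      obtain a b where "ricci (walker_metric f) p =
          a *\<^sub>R walker_metric f p + b *\<^sub>R (\<chi> i j. walker_eta f \<xi>1 \<xi>2 \<xi>3 p $ i * walker_eta f \<xi>1 \<xi>2 \<xi>3 p $ j)"
        using ein p unfolding eta_einstein_def g \<eta> by blast
      note * = eta_einstein_walker_pointwise[OF M(1) smooth(1) p norm[OF p]
          this[unfolded walker_eta_def] nonflat[unfolded g, rule_format, OF p]]
      show "f_xx f p \<noteq> 0" "\<xi>3 p = 0" "(\<xi>2 p)\<^sup>2 = 1" "\<xi>1 p = - (\<xi>2 p * f_xy f p / f_xx f p)"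
        "(f_xy f p)\<^sup>2 - f_xx f p * f_yy f p = 0"
        by (fact *)+
    qed
    have sign: "\<xi>2 p = 1 \<or> \<xi>2 p = - 1" if "p \<in> M" for p
      using pointwise(3)[OF that] by (simp add: power2_eq_1_iff)
    have "\<xi>2 ` M \<subseteq> {1, - 1}"
      using sign by blast
    then have "finite (\<xi>2 ` M)"
      by (rule finite_subset) simp
    moreover have "continuous_on M \<xi>2"
      using smooth(2) smooth_fun_on_imp_differentiable
      by (meson continuous_at_imp_continuous_on differentiable_imp_continuous_within)
    \<comment> \<open>A continuous function with finite range on a connected set is constant. Any
      point of \<open>M\<close> then identifies \<open>c\<close> as 1 or -1; for empty
      \<open>M\<close> both alternatives hold vacuously.\<close>
    ultimately obtain c where "\<forall>p\<in>M. \<xi>2 p = c"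
      using continuous_finite_range_constant[OF M(2)] unfolding constant_on_def by blast
    then have "(\<forall>p\<in>M. \<xi>2 p = 1) \<or> (\<forall>p\<in>M. \<xi>2 p = - 1)"
      using sign by metis
    then show ?thesis
      using pointwise by auto
  qed
  have backward: "eta_einstein M g \<eta> \<and> (\<forall>p\<in>M. \<not> flat_at g p)" if pm: "?plus \<or> ?minus" and deg: ?deg
  proof
    \<comment> \<open>Both are constant multiples of a second derivative of \<open>f\<close>, so
      their smoothness reduces to that of \<open>f\<close>.\<close>
    let ?a = "\<lambda>p. 1/2 * f_xx f p" and ?b = "\<lambda>p. - (1/2) * f_xx f p"
    have "smooth_fun_on M ?a" "smooth_fun_on M ?b"
      by (intro smooth_fun_on_cmult smooth_fun_on_pd M smooth)+
    moreover have "ricci g p = ?a p *\<^sub>R g p + ?b p *\<^sub>R (\<chi> i j. \<eta> p $ i * \<eta> p $ j)" if p: "p \<in> M" for p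
    proof -
      have "\<eta> p = vector [0, \<xi>2 p, \<xi>1 p]"
        using pm p by (auto simp: \<eta> walker_eta_def)
      moreover have "(\<xi>2 p)\<^sup>2 = 1" "\<xi>1 p = - (\<xi>2 p * f_xy f p / f_xx f p)"
        using pm p by auto
      ultimately show ?thesis
        using eta_einstein_walker_pointwise_conv[OF M(1) smooth(1) p, of "\<xi>2 p" "\<xi>1 p"] deg p
        unfolding g by simp
    qed
    ultimately show "eta_einstein M g \<eta>"
      unfolding eta_einstein_def by blast
    show "\<forall>p\<in>M. \<not> flat_at g p"
      using deg not_flat_at_walker[OF M(1) smooth(1)] unfolding g by blast
  qed
  \<comment> \<open>Under \<open>?deg\<close> the explicit eigenbasis supplies the diagonalizability
    clause.\<close>
  have segre: "segre_11_1_degenerate M f \<longleftrightarrow> ?deg"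
    using diagonalizable_ricci_operator_walker[OF M(1) smooth(1)]
    unfolding segre_11_1_degenerate_def by blast
  have xi: "(\<forall>p\<in>M. \<xi> p = walker_N f p) \<longleftrightarrow> ?plus" "(\<forall>p\<in>M. \<xi> p = - walker_N f p) \<longleftrightarrow> ?minus"
    by (simp_all add: \<xi> walker_xi_def walker_N_def vec_eq_iff forall_3)
  have "walker_N f p \<noteq> 0" for p
    by (simp add: walker_N_def vec_eq_iff forall_3)
  moreover have "{v. ricci_operator g p *v v = 0 *\<^sub>R v} = span {walker_N f p}" if ?deg "p \<in> M" for p
    using ricci_operator_kernel_walker[OF M(1) smooth(1) that(2)] that unfolding g by simp
  ultimately show ?thesis
    unfolding segre xi using forward backward by blast
qed

end
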